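(* Let $V$ be a finite dimensional vector space over a field $\mathbb{K}$. Let $\mathrm{LVR}(V)$ denote the set of vector space locality relations on $V$, and let $\mathrm{LGR}(V)$ denote the set of lattice locality relations $\top_G$ on the lattice $G(V)$ of linear subspaces of $V$ such that $\{0\}^{\top_G}=G(V)$. Then the assignments $\top_V\mapsto \top_{V,G}$ and $\top_G\mapsto\top_{G,V}$ give a one-one correspondence between $\mathrm{LVR}(V)$ and $\mathrm{LGR}(V)$ (that is, they are well-defined maps $\mathrm{LVR}(V)\to\mathrm{LGR}(V)$ and $\mathrm{LGR}(V)\to\mathrm{LVR}(V)$ which are inverse to each other), where $$U\,\top_{V,G}\,W \iff u\,\top_V\, w\ \text{ for all } u\in U,\ w\in W \qquad (U,W\in G(V)),$$ $$v_1\,\top_{G,V}\,v_2\iff \mathbb{K}v_1\,\top_G\,\mathbb{K}v_2\qquad (v_1,v_2\in V).$$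
   Context: For a symmetric binary relation $\top$ on a set $X$ and $A\subseteq X$, the polar set is $A^\top:=\{x'\in X\mid x\,\top\, x'\text{ for all }x\in A\}$; for an element $a\in X$, $a^\top:=\{a\}^\top$. A vector space locality relation on $V$ is a symmetric binary relation $\top$ on the set $V$ such that for every subset $X\subseteq V$ the polar set $X^\top$ is a linear subspace of $V$. $G(V)$ is the set of all linear subspaces of $V$, ordered by inclusion; it is a lattice with join the sum $+$ and meet the intersection $\cap$. A poset ideal of a lattice $L$ is a subset $M$ such that $a\in M$, $b\leq a$ imply $b\in M$; a lattice ideal is a poset ideal closed under $\vee$. A lattice locality relation on a lattice $L$ is a symmetric binary relation $\top$ on $L$ such that $a^\top$ is a lattice ideal of $L$ for every $a\in L$. In the condition $\{0\}^{\top_G}=G(V)$, $\{0\}$ is the zero subspace viewed as an element of $G(V)$, so the condition says that the zero subspace is related to every subspace. *)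

theory Defs
  imports Complex_Main "HOL-Algebra.Lattice"
begin

text \<open>
  Relations are sets of pairs contained in \<open>X \<times> X\<close> for an explicit carrier \<open>X\<close>, so that
  equality of relations on \<open>X\<close> is equality of sets. The vector space \<open>V\<close> is the whole type
  \<open>'v\<close>, with scalar multiplication \<open>scale\<close> as in the locale \<open>vector_space\<close>.
\<close>

definition symmetric_relation :: "'a set \<Rightarrow> 'a rel \<Rightarrow> bool" where
  "symmetric_relation X T \<longleftrightarrow> T \<subseteq> X \<times> X \<and> sym T"

definition polar :: "'a set \<Rightarrow> 'a rel \<Rightarrow> 'a set \<Rightarrow> 'a set" where
  "polar X T A = {x' \<in> X. \<forall>x\<in>A. (x, x') \<in> T}"

definition poset_ideal :: "('a, 'b) gorder_scheme \<Rightarrow> 'a set \<Rightarrow> bool" where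
  "poset_ideal L M \<longleftrightarrow>
     M \<subseteq> carrier L \<and> (\<forall>a\<in>M. \<forall>b\<in>carrier L. b \<sqsubseteq>\<^bsub>L\<^esub> a \<longrightarrow> b \<in> M)"

definition lattice_ideal :: "('a, 'b) gorder_scheme \<Rightarrow> 'a set \<Rightarrow> bool" where
  "lattice_ideal L M \<longleftrightarrow> poset_ideal L M \<and> (\<forall>a\<in>M. \<forall>b\<in>M. a \<squnion>\<^bsub>L\<^esub> b \<in> M)"

definition lattice_locality_relation :: "('a, 'b) gorder_scheme \<Rightarrow> 'a rel \<Rightarrow> bool" where
  "lattice_locality_relation L T \<longleftrightarrow>
     symmetric_relation (carrier L) T \<and>
     (\<forall>a\<in>carrier L. lattice_ideal L (polar (carrier L) T {a}))"

definition vector_space_locality_relation ::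
    "('k::field \<Rightarrow> 'v::ab_group_add \<Rightarrow> 'v) \<Rightarrow> 'v rel \<Rightarrow> bool" where
  "vector_space_locality_relation scale T \<longleftrightarrow>
     symmetric_relation UNIV T \<and> (\<forall>X. module.subspace scale (polar UNIV T X))"

definition subspace_lattice ::
    "('k::field \<Rightarrow> 'v::ab_group_add \<Rightarrow> 'v) \<Rightarrow> 'v set gorder" where
  "subspace_lattice scale =
     \<lparr>carrier = {U. module.subspace scale U}, eq = (=), le = (\<subseteq>)\<rparr>"

definition LVR :: "('k::field \<Rightarrow> 'v::ab_group_add \<Rightarrow> 'v) \<Rightarrow> 'v rel set" where
  "LVR scale = {T. vector_space_locality_relation scale T}"

definition LGR :: "('k::field \<Rightarrow> 'v::ab_group_add \<Rightarrow> 'v) \<Rightarrow> 'v set rel set" where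
  "LGR scale =
     {T. lattice_locality_relation (subspace_lattice scale) T \<and>
         polar (carrier (subspace_lattice scale)) T {{0}} = carrier (subspace_lattice scale)}"

definition relation_V_to_G ::
    "('k::field \<Rightarrow> 'v::ab_group_add \<Rightarrow> 'v) \<Rightarrow> 'v rel \<Rightarrow> 'v set rel" where
  "relation_V_to_G scale T =
     {(U, W). U \<in> carrier (subspace_lattice scale) \<and> W \<in> carrier (subspace_lattice scale) \<and>
              (\<forall>u\<in>U. \<forall>w\<in>W. (u, w) \<in> T)}"

definition line :: "('k::field \<Rightarrow> 'v::ab_group_add \<Rightarrow> 'v) \<Rightarrow> 'v \<Rightarrow> 'v set" where
  "line scale v = range (\<lambda>c. scale c v)"

definition relation_G_to_V ::
    "('k::field \<Rightarrow> 'v::ab_group_add \<Rightarrow> 'v) \<Rightarrow> 'v set rel \<Rightarrow> 'v rel" where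
  "relation_G_to_V scale T = {(v\<^sub>1, v\<^sub>2). (line scale v\<^sub>1, line scale v\<^sub>2) \<in> T}"

text \<open>The order-theoretic joins and meets of \<^const>\<open>subspace_lattice\<close> are sums and intersections.\<close>

context vector_space
begin

lemma least_subspace_lattice:
  assumes "subspace U" "subspace W"
  shows "least (subspace_lattice scale) {u + w | u w. u \<in> U \<and> w \<in> W}
           (Upper (subspace_lattice scale) {U, W})"
proof -
  let ?S = "{u + w | u w. u \<in> U \<and> w \<in> W}"
  have "U \<subseteq> ?S"
  proof
    fix u assume "u \<in> U"
    then have "u = u + 0 \<and> u \<in> U \<and> 0 \<in> W" using subspace_0[OF assms(2)] by simp
    then show "u \<in> ?S" by blast
  qed
  moreover have "W \<subseteq> ?S"
  proof
    fix w assume "w \<in> W"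
    then have "w = 0 + w \<and> 0 \<in> U \<and> w \<in> W" using subspace_0[OF assms(1)] by simp
    then show "w \<in> ?S" by blast
  qed
  moreover have "?S \<subseteq> Z" if "subspace Z" "U \<subseteq> Z" "W \<subseteq> Z" for Z
    using that subspace_add[OF that(1)] by blast
  ultimately show ?thesis
    using subspace_sums[OF assms] assms
    unfolding least_def Upper_def subspace_lattice_def by auto
qed

lemma greatest_subspace_lattice:
  assumes "subspace U" "subspace W"
  shows "greatest (subspace_lattice scale) (U \<inter> W) (Lower (subspace_lattice scale) {U, W})"
  using assms subspace_inter[OF assms]
  unfolding greatest_def Lower_def subspace_lattice_def by auto

lemma lattice_subspace_lattice: "Lattice.lattice (subspace_lattice scale)"
proof (unfold_locales, goal_cases)
  case (9 U W)
  then show ?case using least_subspace_lattice[of U W] by (auto simp: subspace_lattice_def)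
next
  case (10 U W)
  then show ?case using greatest_subspace_lattice[of U W] by (auto simp: subspace_lattice_def)
qed (auto simp: subspace_lattice_def)

lemma join_subspace_lattice:
  assumes "subspace U" "subspace W"
  shows "U \<squnion>\<^bsub>subspace_lattice scale\<^esub> W = {u + w | u w. u \<in> U \<and> w \<in> W}"
proof -
  interpret L: Lattice.lattice "subspace_lattice scale" by (rule lattice_subspace_lattice)
  show ?thesis
    unfolding join_def Lattice.sup_def
    by (intro some_equality least_subspace_lattice[OF assms])
      (rule L.least_unique[OF _ least_subspace_lattice[OF assms]])
qed

lemma meet_subspace_lattice:
  assumes "subspace U" "subspace W"
  shows "U \<sqinter>\<^bsub>subspace_lattice scale\<^esub> W = U \<inter> W"
proof -
  interpret L: Lattice.lattice "subspace_lattice scale" by (rule lattice_subspace_lattice)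
  show ?thesis
    unfolding meet_def Lattice.inf_def
    by (intro some_equality greatest_subspace_lattice[OF assms])
      (rule L.greatest_unique[OF _ greatest_subspace_lattice[OF assms]])
qed

end

end

theory Submission
  imports Defs
begin

text \<open>
  Relatedness of subspaces is decided by the lines they contain. For a locality relation on
  \<open>G(V)\<close> with \<open>{0}\<close> related to everything, each \<open>U\<^sup>\<top>\<close> is a lattice ideal containing
  the zero subspace. Such an ideal contains a subspace \<open>W\<close> as soon as it contains every line
  of \<open>W\<close>, because \<open>W\<close> is a join of finitely many of them; this is where finite dimension
  enters (\<open>mem_lattice_ideal_iff_lines\<close>). Using this on one side of the relation and
  then, by symmetry, on the other, \<open>U \<top>\<^sub>G W\<close> holds exactly when all lines of \<open>U\<close> are related to
  all lines of \<open>W\<close>, so \<open>\<top>\<^sub>G\<close> is recovered from its restriction to lines.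

  On the side of \<open>V\<close>, polars are subspaces, so \<open>v \<top> w\<close> forces \<open>cv \<top> dw\<close> for all scalars and the
  relation is determined by its effect on lines. The ideal axioms correspond to the subspace axioms:
  the subspaces contained in a fixed subspace \<open>U\<^sup>\<top>\<close> form a lattice ideal, and conversely
  the vectors whose lines lie in a lattice ideal containing \<open>{0}\<close> form a subspace
  (\<open>subspace_lines_in_lattice_ideal\<close>), since the line of \<open>v + w\<close> lies in the sum of the lines of
  \<open>v\<close> and \<open>w\<close>.
\<close>

lemma carrier_subspace_lattice [simp]:
  "carrier (subspace_lattice scale) = {U. module.subspace scale U}"
  by (simp add: subspace_lattice_def)

context vector_space
begin

lemma line_eq_span: "line scale v = span {v}"
  by (simp add: line_def span_singleton)

lemma join_subspace_lattice_eq_span: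
  assumes "subspace U" "subspace W"
  shows "U \<squnion>\<^bsub>subspace_lattice scale\<^esub> W = span (U \<union> W)"
proof -
  have "span (U \<union> W) = {u + w |u w. u \<in> U \<and> w \<in> W}"
    by (simp add: span_Un span_eq_iff[THEN iffD2, OF assms(1)] span_eq_iff[THEN iffD2, OF assms(2)])
  then show ?thesis
    using join_subspace_lattice[OF assms] by simp
qed

lemma lattice_ideal_subspace_lattice_iff:
  "lattice_ideal (subspace_lattice scale) M \<longleftrightarrow>
     (\<forall>U\<in>M. subspace U) \<and> (\<forall>U\<in>M. \<forall>W. subspace W \<and> W \<subseteq> U \<longrightarrow> W \<in> M) \<and>
     (\<forall>U\<in>M. \<forall>W\<in>M. span (U \<union> W) \<in> M)"
proof -
  have poset: "poset_ideal (subspace_lattice scale) M \<longleftrightarrow>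
     (\<forall>U\<in>M. subspace U) \<and> (\<forall>U\<in>M. \<forall>W. subspace W \<and> W \<subseteq> U \<longrightarrow> W \<in> M)"
    by (auto simp: poset_ideal_def subspace_lattice_def)
  show ?thesis
    unfolding lattice_ideal_def poset
    by (auto simp: join_subspace_lattice_eq_span)
qed

lemma lattice_ideal_subspace_latticeD:
  assumes "lattice_ideal (subspace_lattice scale) M"
  shows "U \<in> M \<Longrightarrow> subspace W \<Longrightarrow> W \<subseteq> U \<Longrightarrow> W \<in> M"
    "U \<in> M \<Longrightarrow> W \<in> M \<Longrightarrow> span (U \<union> W) \<in> M"
    "U \<in> M \<Longrightarrow> subspace U"
  using assms unfolding lattice_ideal_subspace_lattice_iff by blast+

text \<open>
  \<open>span B\<close> is the join of the lines through the elements of \<open>B\<close>. The empty join is the zero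
  subspace, which a lattice ideal contains only if it is nonempty, hence the hypothesis \<open>zero\<close>.
\<close>

lemma span_finite_mem_lattice_ideal:
  assumes I: "lattice_ideal (subspace_lattice scale) I" and zero: "{0} \<in> I"
    and "finite B" "\<And>b. b \<in> B \<Longrightarrow> line scale b \<in> I"
  shows "span B \<in> I"
  using assms(3,4)
proof (induction B)
  case empty
  then show ?case using zero by simp
next
  case (insert b B)
  then have "span {b} \<in> I" "span B \<in> I"
    by (auto simp flip: line_eq_span)
  then have "span (span {b} \<union> span B) \<in> I"
    by (rule lattice_ideal_subspace_latticeD(2)[OF I])
  moreover have "span (span {b} \<union> span B) = span (insert b B)"
    using span_Un[of "span {b}" "span B"] span_Un[of "{b}" B] by (simp only: span_span insert_is_Un[of b B])
  ultimately show ?case by simp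
qed

text \<open>
  The line of \<open>v + w\<close> need not be the sum of the lines of \<open>v\<close> and \<open>w\<close>, but it is contained in it.
  Closure under addition therefore uses both closure properties of a lattice ideal.
\<close>

lemma subspace_lines_in_lattice_ideal:
  assumes I: "lattice_ideal (subspace_lattice scale) I" and zero: "{0} \<in> I"
  shows "subspace {v. line scale v \<in> I}"
proof -
  have down: "line scale v \<in> I" if "U \<in> I" "v \<in> U" for U v
  proof -
    have "span {v} \<subseteq> U"
      using that lattice_ideal_subspace_latticeD(3)[OF I] by (intro span_minimal) auto
    then show ?thesis
      unfolding line_eq_span
      by (rule lattice_ideal_subspace_latticeD(1)[OF I \<open>U \<in> I\<close> subspace_span])
  qed
  show ?thesis
  proof (rule subspaceI; clarify)
    show "line scale 0 \<in> I" using down[OF zero] by simp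
  next
    fix v w assume "line scale v \<in> I" "line scale w \<in> I"
    then have "span {v, w} \<in> I"
      by (intro span_finite_mem_lattice_ideal[OF I zero]) auto
    then show "line scale (v + w) \<in> I"
      by (rule down) (simp add: span_add span_base)
  next
    fix c v assume "line scale v \<in> I"
    then show "line scale (scale c v) \<in> I"
      by (rule down) (simp add: line_eq_span span_base span_scale)
  qed
qed

lemma vector_space_locality_relationD:
  assumes "vector_space_locality_relation scale T"
  shows "sym T" "subspace (polar UNIV T X)"
  using assms by (auto simp: vector_space_locality_relation_def symmetric_relation_def)

lemma relation_V_to_G_in_LGR:
  assumes "T \<in> LVR scale"
  shows "relation_V_to_G scale T \<in> LGR scale"
proof -
  have "vector_space_locality_relation scale T" using assms by (simp add: LVR_def)
  note T = vector_space_locality_relationD[OF this]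
  let ?G = "relation_V_to_G scale T"
  have polar_G: "polar {U. subspace U} ?G {U} = {W. subspace W \<and> W \<subseteq> polar UNIV T U}"
    if "subspace U" for U
    using that by (auto simp: polar_def relation_V_to_G_def)
  have "lattice_ideal (subspace_lattice scale) (polar {U. subspace U} ?G {U})"
    if "subspace U" for U
    unfolding polar_G[OF that] lattice_ideal_subspace_lattice_iff
    using span_minimal[OF _ T(2)[of U]] by (intro conjI ballI allI impI) auto
  moreover have "symmetric_relation {U. subspace U} ?G"
    unfolding symmetric_relation_def relation_V_to_G_def
    by (auto intro!: symI intro: symD[OF T(1)])
  moreover have "polar {U. subspace U} ?G {{0}} = {U. subspace U}"
  proof -
    \<comment> \<open>As a subspace, \<open>{w}\<^sup>\<top>\<close> contains \<open>0\<close> for every \<open>w\<close>.\<close>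
    have "(0, w) \<in> T" for w
      using subspace_0[OF T(2)[of "{w}"]] by (simp add: polar_def symD[OF T(1), of w 0])
    then show ?thesis
      unfolding polar_G[OF subspace_single_0] by (auto simp: polar_def)
  qed
  ultimately show ?thesis
    by (simp add: LGR_def lattice_locality_relation_def)
qed

lemma LGR_D:
  assumes "T \<in> LGR scale"
  shows "sym T" "(U, W) \<in> T \<Longrightarrow> subspace U \<and> subspace W"
    "subspace U \<Longrightarrow> lattice_ideal (subspace_lattice scale) {W. (U, W) \<in> T}"
    "subspace U \<Longrightarrow> (U, {0}) \<in> T"
proof -
  have rel: "symmetric_relation {U. subspace U} T"
    using assms by (simp add: LGR_def lattice_locality_relation_def)
  then show "sym T" "(U, W) \<in> T \<Longrightarrow> subspace U \<and> subspace W"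
    by (auto simp: symmetric_relation_def)
  have "polar {U. subspace U} T {U} = {W. (U, W) \<in> T}"
    using rel by (auto simp: polar_def symmetric_relation_def)
  then show "subspace U \<Longrightarrow> lattice_ideal (subspace_lattice scale) {W. (U, W) \<in> T}"
    using assms by (auto simp: LGR_def lattice_locality_relation_def)
  show "(U, {0}) \<in> T" if "subspace U"
  proof (rule symD[OF \<open>sym T\<close>])
    have "U \<in> polar {U. subspace U} T {{0}}"
      using assms that by (simp add: LGR_def)
    then show "({0}, U) \<in> T" by (simp add: polar_def)
  qed
qed

lemma relation_G_to_V_in_LVR:
  assumes "T \<in> LGR scale"
  shows "relation_G_to_V scale T \<in> LVR scale"
proof -
  note T = LGR_D[OF assms]
  have subspace_line: "subspace (line scale x)" for x
    by (simp add: line_eq_span)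
  have "subspace {v. (line scale x, line scale v) \<in> T}" for x
    using subspace_lines_in_lattice_ideal[OF T(3)[OF subspace_line]] T(4)[OF subspace_line]
    by simp
  then have "subspace (\<Inter>x\<in>X. {v. (line scale x, line scale v) \<in> T})" for X
    by (intro subspace_Inter) auto
  moreover have "polar UNIV (relation_G_to_V scale T) X =
      (\<Inter>x\<in>X. {v. (line scale x, line scale v) \<in> T})" for X
    by (auto simp: polar_def relation_G_to_V_def)
  moreover have "sym (relation_G_to_V scale T)"
    by (auto simp: relation_G_to_V_def intro!: symI intro: symD[OF T(1)])
  ultimately show ?thesis
    by (simp add: LVR_def vector_space_locality_relation_def symmetric_relation_def)
qed

lemma relation_G_to_V_V_to_G:
  assumes "T \<in> LVR scale"
  shows "relation_G_to_V scale (relation_V_to_G scale T) = T"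
proof -
  have "vector_space_locality_relation scale T" using assms by (simp add: LVR_def)
  note T = vector_space_locality_relationD[OF this]
  have right: "(v, scale d w) \<in> T" if "(v, w) \<in> T" for v w d
    using subspace_scale[OF T(2)[of "{v}"], of w d] that by (simp add: polar_def)
  have both: "(scale c v, scale d w) \<in> T" if "(v, w) \<in> T" for v w c d
    using symD[OF T(1) right[OF symD[OF T(1) right[OF that]]]] .
  have "(line scale v, line scale w) \<in> relation_V_to_G scale T \<longleftrightarrow> (v, w) \<in> T" for v w
  proof
    assume "(line scale v, line scale w) \<in> relation_V_to_G scale T"
    moreover have "v \<in> line scale v" "w \<in> line scale w"
      by (simp_all add: line_eq_span span_base)
    ultimately show "(v, w) \<in> T" by (simp add: relation_V_to_G_def)
  next
    assume "(v, w) \<in> T"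
    then have "\<forall>u\<in>line scale v. \<forall>u'\<in>line scale w. (u, u') \<in> T"
      using both by (auto simp: line_def)
    then show "(line scale v, line scale w) \<in> relation_V_to_G scale T"
      by (simp add: relation_V_to_G_def line_eq_span)
  qed
  then show ?thesis by (auto simp: relation_G_to_V_def)
qed

end

context finite_dimensional_vector_space
begin

text \<open>
  Finite joins suffice to build \<open>W\<close> from its lines because \<open>W\<close> has a finite basis. In infinite
  dimension the finite-dimensional subspaces form a lattice ideal that contains every line
  but not the whole space.
\<close>

lemma mem_lattice_ideal_iff_lines:
  assumes I: "lattice_ideal (subspace_lattice scale) I" and zero: "{0} \<in> I"
    and W: "subspace W"
  shows "W \<in> I \<longleftrightarrow> (\<forall>w\<in>W. line scale w \<in> I)"
proof
  assume "W \<in> I"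
  moreover have "line scale w \<subseteq> W" if "w \<in> W" for w
    using that W by (simp add: line_eq_span span_minimal)
  ultimately show "\<forall>w\<in>W. line scale w \<in> I"
    using lattice_ideal_subspace_latticeD(1)[OF I] by (simp add: line_eq_span)
next
  assume lines: "\<forall>w\<in>W. line scale w \<in> I"
  obtain B where B: "B \<subseteq> W" "independent B" "W \<subseteq> span B"
    by (rule basis_exists[of W])
  have "span B \<in> I"
    using B lines by (intro span_finite_mem_lattice_ideal[OF I zero])
      (auto intro: finiteI_independent)
  moreover have "span B = W"
    using span_minimal[OF B(1) W] B(3) by blast
  ultimately show "W \<in> I" by simp
qed

lemma relation_V_to_G_G_to_V:
  assumes "T \<in> LGR scale"
  shows "relation_V_to_G scale (relation_G_to_V scale T) = T"
proof -
  note T = LGR_D[OF assms]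
  have comm: "(U, W) \<in> T \<longleftrightarrow> (W, U) \<in> T" for U W
    using symD[OF T(1)] by blast
  \<comment> \<open>The ideal \<open>U\<^sup>\<top>\<close> sees only the lines of \<open>W\<close>; symmetry lets the same be said of \<open>U\<close>.\<close>
  have right: "(U, W) \<in> T \<longleftrightarrow> (\<forall>w\<in>W. (U, line scale w) \<in> T)"
    if "subspace U" "subspace W" for U W
    using mem_lattice_ideal_iff_lines[OF T(3)] T(4) that by simp
  have lines: "(U, W) \<in> T \<longleftrightarrow> (\<forall>u\<in>U. \<forall>w\<in>W. (line scale u, line scale w) \<in> T)"
    if "subspace U" "subspace W" for U W
  proof -
    have "(U, W) \<in> T \<longleftrightarrow> (\<forall>w\<in>W. (line scale w, U) \<in> T)"
      using right[OF that] comm by blast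
    also have "\<dots> \<longleftrightarrow> (\<forall>w\<in>W. \<forall>u\<in>U. (line scale w, line scale u) \<in> T)"
      using right that by (simp add: line_eq_span)
    also have "\<dots> \<longleftrightarrow> (\<forall>u\<in>U. \<forall>w\<in>W. (line scale u, line scale w) \<in> T)"
      using comm by blast
    finally show ?thesis .
  qed
  have "(U, W) \<in> relation_V_to_G scale (relation_G_to_V scale T) \<longleftrightarrow>
      subspace U \<and> subspace W \<and> (\<forall>u\<in>U. \<forall>w\<in>W. (line scale u, line scale w) \<in> T)" for U W
    by (simp add: relation_V_to_G_def relation_G_to_V_def)
  then have "(U, W) \<in> relation_V_to_G scale (relation_G_to_V scale T) \<longleftrightarrow> (U, W) \<in> T" for U W
    using lines[of U W] T(2)[of U W] by blast
  then show ?thesis by (simp add: set_eq_iff split_paired_all)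
qed

end

theorem proposition6p1:
  fixes scale :: "'k::field \<Rightarrow> 'v::ab_group_add \<Rightarrow> 'v"
    and Basis :: "'v set"
  assumes "finite_dimensional_vector_space scale Basis"
  shows "relation_V_to_G scale \<in> LVR scale \<rightarrow> LGR scale \<and>
         relation_G_to_V scale \<in> LGR scale \<rightarrow> LVR scale \<and>
         (\<forall>T\<in>LVR scale. relation_G_to_V scale (relation_V_to_G scale T) = T) \<and>
         (\<forall>T\<in>LGR scale. relation_V_to_G scale (relation_G_to_V scale T) = T)"
proof -
  interpret finite_dimensional_vector_space scale Basis by (rule assms)
  show ?thesis
    using relation_V_to_G_in_LGR relation_G_to_V_in_LVR
      relation_G_to_V_V_to_G relation_V_to_G_G_to_V by blast
qed

end
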